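(* Let $\delta>0$, and let $\phi\in C^2(\overline\Omega)$ be any nonnegative function such that $\phi\not\equiv0$ and $\phi=0$ on $\partial\Omega$. Then for all $\lambda$ large enough, the quenching time $T$ of the solution of $(F_{\lambda,\delta})$ satisfies $$T\le\frac{\|\phi\|_1}{3\lambda\|\phi\|_1-\|\Delta\phi\|_1},$$ where $\|\cdot\|_1$ denotes the $L^1(\Omega)$ norm.
   Context: $\Omega\subset\mathbb{R}^n$ is a bounded domain, $\lambda>0$. The parabolic problem $(F_{\lambda,\delta})$ is $$u_t-\Delta u=\lambda\frac{1+\delta|\nabla u|^2}{(1-u)^2}\ \text{ in }\Omega\times[0,T),\qquad u=0\ \text{ on }\partial\Omega\times[0,T),\qquad u(x,0)=0\ \text{ for }x\in\Omega.$$ The quenching time is $T=\sup\{t>0:\ \|u(\cdot,\tau)\|_\infty<1\ \ \forall\tau\in[0,t]\}$. *)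

theory Defs
  imports "HOL-Analysis.Analysis"
begin

definition partial_deriv :: "'a::euclidean_space \<Rightarrow> ('a \<Rightarrow> real) \<Rightarrow> 'a \<Rightarrow> real" where
  "partial_deriv b f x = deriv (\<lambda>s. f (x + s *\<^sub>R b)) 0"

definition grad :: "('a::euclidean_space \<Rightarrow> real) \<Rightarrow> 'a \<Rightarrow> 'a" where
  "grad f x = (\<Sum>b\<in>Basis. partial_deriv b f x *\<^sub>R b)"

definition laplacian :: "('a::euclidean_space \<Rightarrow> real) \<Rightarrow> 'a \<Rightarrow> real" where
  "laplacian f x = (\<Sum>b\<in>Basis. partial_deriv b (partial_deriv b f) x)"

(* For open S.  The differentiability clauses guarantee that the partial derivatives, which are
   total functions here, are genuine ones. *)
definition C2_on :: "'a::euclidean_space set \<Rightarrow> ('a \<Rightarrow> real) \<Rightarrow> bool" where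
  "C2_on S f \<longleftrightarrow>
     f differentiable_on S \<and>
     (\<forall>b\<in>Basis. partial_deriv b f differentiable_on S) \<and>
     (\<forall>b\<in>Basis. \<forall>c\<in>Basis. continuous_on S (partial_deriv b (partial_deriv c f)))"

definition extends_continuously :: "'a::euclidean_space set \<Rightarrow> ('a \<Rightarrow> real) \<Rightarrow> bool" where
  "extends_continuously S f \<longleftrightarrow>
     (\<exists>g. continuous_on (closure S) g \<and> (\<forall>x\<in>S. g x = f x))"

(* C^2 of the closure of an open set S: the function is C^2 in S, and it and all its partial
   derivatives of order at most 2 extend continuously to the closure.  No regularity of the
   boundary of S and no extension of f beyond the closure is required. *)
definition C2_on_closure :: "'a::euclidean_space set \<Rightarrow> ('a \<Rightarrow> real) \<Rightarrow> bool" where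
  "C2_on_closure S f \<longleftrightarrow>
     C2_on S f \<and> continuous_on (closure S) f \<and>
     (\<forall>b\<in>Basis. extends_continuously S (partial_deriv b f)) \<and>
     (\<forall>b\<in>Basis. \<forall>c\<in>Basis. extends_continuously S (partial_deriv b (partial_deriv c f)))"

(* C^{2,1}: two space derivatives and one time derivative, all jointly continuous on S \<times> J
   (S and J open). *)
definition C21_on :: "'a::euclidean_space set \<Rightarrow> real set \<Rightarrow> ('a \<Rightarrow> real \<Rightarrow> real) \<Rightarrow> bool" where
  "C21_on S J u \<longleftrightarrow>
     (\<forall>t\<in>J. C2_on S (\<lambda>x. u x t)) \<and>
     (\<forall>x\<in>S. u x differentiable_on J) \<and>
     continuous_on (S \<times> J) (\<lambda>(x, t). deriv (u x) t) \<and>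
     (\<forall>b\<in>Basis. continuous_on (S \<times> J) (\<lambda>(x, t). partial_deriv b (\<lambda>y. u y t) x)) \<and>
     (\<forall>b\<in>Basis. \<forall>c\<in>Basis. continuous_on (S \<times> J)
        (\<lambda>(x, t). partial_deriv b (partial_deriv c (\<lambda>y. u y t)) x))"

(* Classical solutions of (F_{lambda,delta}) on the time interval [0,T), where 0 < T \<le> \<infinity>.
   As usual for classical solutions, the equation is imposed at positive times and u is required
   to be continuous up to the parabolic boundary.  Regularity of u_t or of the second space
   derivatives up to the boundary at t = 0 must not be required: on the boundary at t = 0 the
   boundary and initial data would force u_t - Laplace u = 0, whereas the right-hand side is
   at least lambda there. *)
definition solves_F ::
    "'a::euclidean_space set \<Rightarrow> real \<Rightarrow> real \<Rightarrow> ereal \<Rightarrow> ('a \<Rightarrow> real \<Rightarrow> real) \<Rightarrow> bool" where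
  "solves_F \<Omega> lam \<delta> T u \<longleftrightarrow>
     0 < T \<and>
     continuous_on (closure \<Omega> \<times> {t. 0 \<le> t \<and> ereal t < T}) (\<lambda>(x, t). u x t) \<and>
     C21_on \<Omega> {t. 0 < t \<and> ereal t < T} u \<and>
     (\<forall>x\<in>\<Omega>. \<forall>t. 0 < t \<and> ereal t < T \<longrightarrow>
        deriv (u x) t - laplacian (\<lambda>y. u y t) x
          = lam * ((1 + \<delta> * (norm (grad (\<lambda>y. u y t) x))\<^sup>2) / (1 - u x t)\<^sup>2)) \<and>
     (\<forall>x\<in>frontier \<Omega>. \<forall>t. 0 \<le> t \<and> ereal t < T \<longrightarrow> u x t = 0) \<and>
     (\<forall>x\<in>\<Omega>. u x 0 = 0)"

(* Taken in ereal, so that the supremum is meaningful for unbounded functions too.  For functions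
   continuous on the open set S this is the L^\<infinity> norm. *)
definition sup_norm_on :: "'a set \<Rightarrow> ('a \<Rightarrow> real) \<Rightarrow> ereal" where
  "sup_norm_on S f = (SUP x\<in>S. ereal \<bar>f x\<bar>)"

(* Used as "solves_F \<Omega> lam \<delta> T u" with "T = quenching_time \<Omega> u": u solves the problem on [0,T)
   and T is its quenching time.  Since u is total in t, a solution that exists only up to time T is
   represented by giving u any values of sup norm at least 1 (e.g. u = 1) from time T on.
   The denominator (1 - u)^2 does not vanish on \<Omega> \<times> [0,T). *)
definition quenching_time :: "'a set \<Rightarrow> ('a \<Rightarrow> real \<Rightarrow> real) \<Rightarrow> ereal" where
  "quenching_time \<Omega> u =
     Sup (ereal ` {t. 0 < t \<and> (\<forall>\<tau>\<in>{0..t}. sup_norm_on \<Omega> (\<lambda>x. u x \<tau>) < 1)})"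

definition L1_norm_on :: "'a::euclidean_space set \<Rightarrow> ('a \<Rightarrow> real) \<Rightarrow> real" where
  "L1_norm_on S f = (LINT x:S|lborel. \<bar>f x\<bar>)"

end

theory Submission
  imports Defs
begin

text \<open>
  Put \<open>W = 1 - (1 - u) ^ 3\<close>. Since \<open>\<nabla>W = 3 (1 - u)\<^sup>2 \<nabla>u\<close>, multiplying the equation by
  \<open>3 (1 - u)\<^sup>2\<close> cancels the singular denominator and gives
  \<open>W\<^sub>t - 3 (1 - u)\<^sup>2 \<Delta>u = 3 \<lambda> (1 + \<delta> \<bar>\<nabla>u\<bar>\<^sup>2) \<ge> 3 \<lambda>\<close>, where
  \<open>3 (1 - u)\<^sup>2 \<Delta>u = \<Delta>W + 6 (1 - u) \<bar>\<nabla>u\<bar>\<^sup>2 \<ge> \<Delta>W\<close>. By the minimum principle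
  \<open>u \<ge> 0\<close> (\<open>supersolution_nonneg\<close>), hence \<open>0 \<le> W \<le> 1\<close> before quenching. Testing with \<open>\<phi>\<close> and
  integrating by parts twice, the function \<open>F(t) = \<integral> \<phi> W\<close> satisfies
  \<open>F' \<ge> 3 \<lambda> \<parallel>\<phi>\<parallel>\<^sub>1 + \<integral> W \<Delta>\<phi> \<ge> 3 \<lambda> \<parallel>\<phi>\<parallel>\<^sub>1 - \<parallel>\<Delta>\<phi>\<parallel>\<^sub>1\<close>.
  As \<open>0 \<le> F \<le> \<parallel>\<phi>\<parallel>\<^sub>1\<close>, this cannot last longer than the asserted time.

  The boundary of the domain is arbitrary and \<open>u\<close> need not be differentiable there, so the
  integration by parts is not available as it stands. It is carried out with \<open>\<phi>\<close> replaced by \<open>G \<circ> \<phi>\<close>, where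
  \<open>G = cutoff e\<close> is convex, vanishes on \<open>(-\<infinity>, e]\<close>, has slopes in \<open>[0, 1]\<close> and satisfies
  \<open>s - 3 e \<le> G s \<le> s\<close> for \<open>s \<ge> 0\<close>. As \<open>\<phi>\<close> vanishes on the boundary, \<open>G \<circ> \<phi>\<close> has compact support
  in the domain; and as \<open>G\<close> is convex and \<open>W \<ge> 0\<close>, replacing \<open>\<phi>\<close> costs nothing in the estimate:
  \<open>W \<Delta>(G \<circ> \<phi>) \<ge> W G'(\<phi>) \<Delta>\<phi> \<ge> - \<bar>\<Delta>\<phi>\<bar>\<close> (\<open>weighted_laplacian_lower_bound\<close>). The resulting
  bound (\<open>time_bound_cutoff\<close>) passes to the limit \<open>e \<rightarrow> 0\<close> (\<open>quenching_time_bound\<close>).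
\<close>

section \<open>Integration by parts for compactly supported functions\<close>

lemma has_real_derivative_along_line:
  fixes f :: "'a::real_normed_vector \<Rightarrow> real"
  assumes "((\<lambda>r. f ((x + s *\<^sub>R b) + r *\<^sub>R b)) has_real_derivative D) (at 0)"
  shows "((\<lambda>r. f (x + r *\<^sub>R b)) has_real_derivative D) (at s)"
proof -
  have "((\<lambda>r. f (x + (r + s) *\<^sub>R b)) has_real_derivative D) (at 0)"
    using assms by (simp add: algebra_simps)
  then show ?thesis
    using DERIV_shift[of "\<lambda>r. f (x + r *\<^sub>R b)" D 0 s] by simp
qed

lemma has_integral_translate_supported:
  fixes f :: "'a::euclidean_space \<Rightarrow> real"
  assumes "(f has_integral i) (cbox c d)"
    and "\<And>x. x \<notin> cbox c d \<Longrightarrow> f x = 0"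
    and "\<And>x. x + v \<in> cbox c d \<Longrightarrow> x \<in> cbox c' d'"
  shows "((\<lambda>x. f (x + v)) has_integral i) (cbox c' d')"
proof -
  have "((\<lambda>x. f (x + v)) has_integral i) ((\<lambda>x. x - v) ` cbox c d)"
    using has_integral_affinity[OF assms(1), of 1 v] by simp
  then show ?thesis
  proof (rule has_integral_on_superset)
    fix x assume "x \<notin> (\<lambda>x. x - v) ` cbox c d"
    then have "x + v \<notin> cbox c d" by (force simp: image_iff)
    then show "f (x + v) = 0" by (rule assms(2))
  next
    show "(\<lambda>x. x - v) ` cbox c d \<subseteq> cbox c' d'" using assms(3) by auto
  qed
qed

text \<open>
  The integral of \<open>x \<mapsto> f (x + s b)\<close> does not depend on \<open>s\<close>, by translation invariance;
  differentiating under the integral sign at \<open>s = 0\<close> gives the claim. This stands in for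
  the divergence theorem.
\<close>

lemma integral_directional_derivative_eq_0:
  fixes f g :: "'a::euclidean_space \<Rightarrow> real"
  assumes f: "continuous_on UNIV f" and g: "continuous_on UNIV g"
    and D: "\<And>x. ((\<lambda>s. f (x + s *\<^sub>R b)) has_real_derivative g x) (at 0)"
    and supp: "\<And>x. x \<notin> cbox c d \<Longrightarrow> f x = 0"
  shows "integral (cbox c d) g = 0"
proof -
  have g0: "g x = 0" if "x \<notin> cbox c d" for x
  proof -
    have "((\<lambda>s. x + s *\<^sub>R b) \<longlongrightarrow> x + 0 *\<^sub>R b) (at 0)"
      by (intro tendsto_intros)
    moreover have "open (- cbox c d)" by auto
    ultimately have "\<forall>\<^sub>F s in at 0. x + s *\<^sub>R b \<in> - cbox c d"
      using that topological_tendstoD by fastforce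
    then have "\<forall>\<^sub>F s in at 0. f (x + s *\<^sub>R b) = 0"
      by eventually_elim (use supp in auto)
    then have "\<forall>\<^sub>F s in nhds 0. f (x + s *\<^sub>R b) = 0"
      using supp[OF that] by (auto simp: eventually_nhds_conv_at)
    then have "((\<lambda>s. f (x + s *\<^sub>R b)) has_real_derivative 0) (at 0)"
      by (subst DERIV_cong_ev[where g="\<lambda>_. 0"]) auto
    with D[of x] show ?thesis using DERIV_unique by blast
  qed
  \<comment> \<open>\<open>A\<close> collects the supports of all translates with \<open>\<bar>s\<bar> \<le> 1\<close>, so that one box serves them all.\<close>
  define A where "A = (\<lambda>(x, s). x - s *\<^sub>R b) ` (cbox c d \<times> {-1..1::real})"
  have "compact A"
    unfolding A_def
    by (intro compact_continuous_image compact_Times compact_cbox compact_Icc)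
      (auto intro!: continuous_intros simp: split_beta)
  then obtain e where e: "A \<subseteq> cbox (-e) e"
    using bounded_subset_cbox_symmetric compact_imp_bounded by metis
  have trans: "((\<lambda>x. h (x + s *\<^sub>R b)) has_integral integral (cbox c d) h) (cbox (-e) e)"
    if "continuous_on UNIV h" "\<And>x. x \<notin> cbox c d \<Longrightarrow> h x = 0" "s \<in> {-1..1}"
    for h :: "'a \<Rightarrow> real" and s
  proof (rule has_integral_translate_supported[where f = h and c = c and d = d])
    show "(h has_integral integral (cbox c d) h) (cbox c d)"
      using that(1) by (meson continuous_on_subset integrable_continuous integrable_integral top_greatest)
    show "\<And>x. x \<notin> cbox c d \<Longrightarrow> h x = 0" by (rule that(2))
    show "x \<in> cbox (-e) e" if "x + s *\<^sub>R b \<in> cbox c d" for x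
    proof -
      have "x = (\<lambda>(x, s). x - s *\<^sub>R b) (x + s *\<^sub>R b, s)" by simp
      with that \<open>s \<in> {-1..1}\<close> have "x \<in> A" unfolding A_def by blast
      with e show ?thesis by auto
    qed
  qed
  have "((\<lambda>s. integral (cbox (-e) e) (\<lambda>x. f (x + s *\<^sub>R b))) has_field_derivative
      integral (cbox (-e) e) (\<lambda>x. g (x + 0 *\<^sub>R b))) (at 0 within {-1..1})"
  proof (rule leibniz_rule_field_derivative)
    show "((\<lambda>s. f (x + s *\<^sub>R b)) has_field_derivative g (x + s *\<^sub>R b)) (at s within {-1..1})" for s x
      using has_real_derivative_along_line[OF D] has_field_derivative_at_within by blast
    show "(\<lambda>x. f (x + s *\<^sub>R b)) integrable_on cbox (-e) e" if "s \<in> {-1..1}" for s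
      using trans[OF f supp that] by blast
    show "continuous_on ({-1..1} \<times> cbox (-e) e) (\<lambda>(s, x). g (x + s *\<^sub>R b))"
      unfolding split_beta
      by (rule continuous_on_compose2[OF g]) (auto intro!: continuous_intros)
  qed auto
  then have "((\<lambda>s. integral (cbox c d) f) has_field_derivative
      integral (cbox (-e) e) (\<lambda>x. g (x + 0 *\<^sub>R b))) (at 0 within {-1..1})"
  proof (rule has_field_derivative_transform_within[OF _ zero_less_one])
    show "integral (cbox (-e) e) (\<lambda>x. f (x + s *\<^sub>R b)) = integral (cbox c d) f"
      if "s \<in> {-1..1}" for s
      using trans[OF f supp that] by (rule integral_unique)
  qed simp
  moreover have "at (0::real) within {-1..1} = at 0"
    by (rule at_within_interior) auto
  ultimately have "integral (cbox (-e) e) (\<lambda>x. g (x + 0 *\<^sub>R b)) = 0"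
    using DERIV_const DERIV_unique by metis
  moreover have "integral (cbox (-e) e) (\<lambda>x. g (x + 0 *\<^sub>R b)) = integral (cbox c d) g"
    using trans[OF g g0, of 0] by auto
  ultimately show ?thesis by simp
qed

text \<open>
  Both \<open>S\<close> and the complement of \<open>K\<close> are open, they cover the space, and the extension is continuous
  on each of them. The parameter set \<open>V\<close> will be a time interval.
\<close>

lemma continuous_on_extend_by_zero:
  fixes h :: "'a::topological_space \<times> 'b::topological_space \<Rightarrow> real"
  assumes h: "continuous_on (V \<times> S) h" and S: "open S" "closed K" "K \<subseteq> S"
    and h0: "\<And>v x. v \<in> V \<Longrightarrow> x \<in> S - K \<Longrightarrow> h (v, x) = 0"
  shows "continuous_on (V \<times> UNIV) (\<lambda>(v, x). if x \<in> S then h (v, x) else 0)"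
proof -
  let ?h = "\<lambda>(v, x). if x \<in> S then h (v, x) else 0"
  have eq: "V \<times> UNIV = V \<times> S \<union> V \<times> (- K)" using S by auto
  have "continuous_on (V \<times> S) ?h"
    by (rule continuous_on_eq[OF h]) auto
  moreover have "continuous_on (V \<times> (- K)) ?h"
    by (rule continuous_on_eq[OF continuous_on_const[of _ 0]]) (auto simp: h0)
  moreover have "openin (top_of_set (V \<times> UNIV)) (V \<times> S)"
    using S by (auto simp: openin_open intro!: exI[of _ "UNIV \<times> S"] open_Times)
  moreover have "openin (top_of_set (V \<times> UNIV)) (V \<times> (- K))"
    using S by (auto simp: openin_open intro!: exI[of _ "UNIV \<times> (- K)"] open_Times)
  ultimately show ?thesis
    unfolding eq by (intro continuous_on_Un_local_open) (auto simp: eq[symmetric])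
qed

lemma continuous_on_extend_by_zero_UNIV:
  fixes h :: "'b::topological_space \<Rightarrow> real"
  assumes h: "continuous_on S h" and S: "open S" "closed K" "K \<subseteq> S"
    and h0: "\<And>x. x \<in> S - K \<Longrightarrow> h x = 0"
  shows "continuous_on UNIV (\<lambda>x. if x \<in> S then h x else 0)"
proof -
  have "continuous_on ({0::real} \<times> UNIV) (\<lambda>(v, x). if x \<in> S then (h \<circ> snd) (v, x) else 0)"
    by (rule continuous_on_extend_by_zero[OF _ S])
      (auto simp: h0 o_def intro!: continuous_on_compose2[OF h] continuous_intros)
  then have "continuous_on UNIV (\<lambda>x. (\<lambda>(v, x). if x \<in> S then (h \<circ> snd) (v, x) else 0) (0::real, x))"
    by (rule continuous_on_compose2) (auto intro!: continuous_intros)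
  then show ?thesis by (simp cong: if_cong)
qed

lemma integrable_on_compact_support:
  fixes h :: "'a::euclidean_space \<Rightarrow> real"
  assumes S: "open S" "closed K" "K \<subseteq> S" "bounded S"
    and h: "continuous_on S h" "\<And>x. x \<in> S - K \<Longrightarrow> h x = 0"
  shows "h integrable_on S"
proof -
  obtain c where c: "S \<subseteq> cbox (-c) c"
    using S bounded_subset_cbox_symmetric by metis
  have "(\<lambda>x. if x \<in> S then h x else 0) integrable_on cbox (-c) c"
    by (intro integrable_continuous continuous_on_subset[OF continuous_on_extend_by_zero_UNIV[OF h(1) S(1-3) h(2)]]) auto
  then show ?thesis
    unfolding Henstock_Kurzweil_Integration.integrable_restrict_Int using c by (simp add: Int_absorb2)
qed

lemma integral_has_real_derivative_compact_support:
  fixes h h' :: "real \<Rightarrow> 'a::euclidean_space \<Rightarrow> real"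
  assumes S: "open S" "closed K" "K \<subseteq> S" "bounded S"
    and J: "open J" "convex J" "s \<in> J"
    and h: "\<And>x s. x \<in> S \<Longrightarrow> s \<in> J \<Longrightarrow> ((\<lambda>s. h s x) has_real_derivative h' s x) (at s)"
    and cont: "\<And>s. s \<in> J \<Longrightarrow> continuous_on S (h s)"
      "continuous_on (J \<times> S) (\<lambda>(s, x). h' s x)"
    and 0: "\<And>x s. x \<in> S - K \<Longrightarrow> s \<in> J \<Longrightarrow> h s x = 0 \<and> h' s x = 0"
  shows "((\<lambda>s. integral S (h s)) has_real_derivative integral S (h' s)) (at s)"
proof -
  obtain c where c: "S \<subseteq> cbox (-c) c"
    using S bounded_subset_cbox_symmetric by metis
  have "((\<lambda>s. integral (cbox (-c) c) (\<lambda>x. if x \<in> S then h s x else 0)) has_real_derivative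
      integral (cbox (-c) c) (\<lambda>x. if x \<in> S then h' s x else 0)) (at s within J)"
  proof (rule leibniz_rule_field_derivative)
    show "((\<lambda>s. if x \<in> S then h s x else 0) has_real_derivative (if x \<in> S then h' s x else 0))
        (at s within J)" if "s \<in> J" for s x
      using h[of x s] that has_field_derivative_at_within by auto
    show "(\<lambda>x. if x \<in> S then h s x else 0) integrable_on cbox (-c) c" if "s \<in> J" for s
      unfolding Henstock_Kurzweil_Integration.integrable_restrict_Int Int_absorb2[OF c]
      by (rule integrable_on_compact_support[OF S cont(1)[OF that]]) (use 0 that in auto)
    have "continuous_on (J \<times> UNIV) (\<lambda>(s, x). if x \<in> S then (\<lambda>(s, x). h' s x) (s, x) else 0)"
      by (rule continuous_on_extend_by_zero[OF cont(2) S(1-3)]) (use 0 in auto)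
    then show "continuous_on (J \<times> cbox (-c) c) (\<lambda>(s, x). if x \<in> S then h' s x else 0)"
      by (rule continuous_on_subset[THEN continuous_on_eq]) auto
  qed (use J in auto)
  moreover have "S \<inter> cbox (-c) c = S" using c by blast
  ultimately show ?thesis
    unfolding Henstock_Kurzweil_Integration.integral_restrict_Int at_within_open[OF J(3,1)] by simp
qed

text \<open>
  Green's second identity, one direction at a time: \<open>p w'' - w p''\<close> is the derivative of
  \<open>p w' - w p'\<close>, which has compact support. The derivatives are given as functions because in the
  application \<open>p\<close> and \<open>w\<close> are compositions whose derivatives are known explicitly.
\<close>

lemma integral_second_derivative_swap:
  fixes p p1 p2 w w1 w2 :: "'a::euclidean_space \<Rightarrow> real"
  assumes S: "open S" "closed K" "K \<subseteq> S" "bounded S"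
    and p: "\<And>x. x \<in> S \<Longrightarrow> ((\<lambda>s. p (x + s *\<^sub>R b)) has_real_derivative p1 x) (at 0)"
    and p1: "\<And>x. x \<in> S \<Longrightarrow> ((\<lambda>s. p1 (x + s *\<^sub>R b)) has_real_derivative p2 x) (at 0)"
    and w: "\<And>x. x \<in> S \<Longrightarrow> ((\<lambda>s. w (x + s *\<^sub>R b)) has_real_derivative w1 x) (at 0)"
    and w1: "\<And>x. x \<in> S \<Longrightarrow> ((\<lambda>s. w1 (x + s *\<^sub>R b)) has_real_derivative w2 x) (at 0)"
    and cont: "continuous_on S p" "continuous_on S p1" "continuous_on S p2"
      "continuous_on S w" "continuous_on S w1" "continuous_on S w2"
    and 0: "\<And>x. x \<in> S - K \<Longrightarrow> p x = 0 \<and> p1 x = 0 \<and> p2 x = 0"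
  shows "integral S (\<lambda>x. p x * w2 x) = integral S (\<lambda>x. w x * p2 x)"
proof -
  obtain c where c: "S \<subseteq> cbox (-c) c"
    using S bounded_subset_cbox_symmetric by metis
  note ext = continuous_on_extend_by_zero_UNIV[OF _ S(1-3)]
  let ?f = "\<lambda>x. if x \<in> S then p x * w1 x - w x * p1 x else 0"
  let ?g = "\<lambda>x. if x \<in> S then p x * w2 x - w x * p2 x else 0"
  have near: "\<forall>\<^sub>F s in nhds 0. x + s *\<^sub>R b \<in> U" if "open U" "x \<in> U" for x U
  proof -
    have "((\<lambda>s. x + s *\<^sub>R b) \<longlongrightarrow> x + 0 *\<^sub>R b) (nhds 0)"
      by (intro tendsto_intros) (simp add: filterlim_ident)
    then show ?thesis using that topological_tendstoD by fastforce
  qed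
  have "integral (cbox (-c) c) ?g = 0"
  proof (rule integral_directional_derivative_eq_0[where f = ?f and b = b])
    show "continuous_on UNIV ?f" "continuous_on UNIV ?g"
      using 0 by (auto intro!: ext continuous_intros cont)
    show "?f x = 0" if "x \<notin> cbox (-c) c" for x using that c by auto
    show "((\<lambda>s. ?f (x + s *\<^sub>R b)) has_real_derivative ?g x) (at 0)" for x
    proof (cases "x \<in> S")
      case True
      have "((\<lambda>s. p (x + s *\<^sub>R b) * w1 (x + s *\<^sub>R b) - w (x + s *\<^sub>R b) * p1 (x + s *\<^sub>R b))
          has_real_derivative ?g x) (at 0)"
        using True by (auto intro!: derivative_eq_intros p p1 w w1 simp: algebra_simps)
      moreover have "\<forall>\<^sub>F s in nhds 0. ?f (x + s *\<^sub>R b) =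
          p (x + s *\<^sub>R b) * w1 (x + s *\<^sub>R b) - w (x + s *\<^sub>R b) * p1 (x + s *\<^sub>R b)"
        using near[OF S(1) True] by eventually_elim simp
      ultimately show ?thesis by (subst DERIV_cong_ev[OF refl _ refl])
    next
      case False
      have "\<forall>\<^sub>F s in nhds 0. x + s *\<^sub>R b \<in> - K"
        using False S by (intro near) auto
      then have "\<forall>\<^sub>F s in nhds 0. ?f (x + s *\<^sub>R b) = 0"
        by eventually_elim (use 0 in auto)
      then show ?thesis using False by (subst DERIV_cong_ev[OF refl _ refl, where g="\<lambda>_. 0"]) auto
    qed
  qed
  moreover have "integral (cbox (-c) c) ?g = integral S (\<lambda>x. p x * w2 x - w x * p2 x)"
    unfolding Henstock_Kurzweil_Integration.integral_restrict_Int using c by (simp add: Int_absorb2)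
  moreover have "(\<lambda>x. p x * w2 x) integrable_on S" "(\<lambda>x. w x * p2 x) integrable_on S"
    by (rule integrable_on_compact_support[OF S]; use 0 in \<open>auto intro!: continuous_intros cont\<close>)+
  ultimately show ?thesis by (simp add: Henstock_Kurzweil_Integration.integral_diff)
qed

section \<open>Partial derivatives and the minimum principle\<close>

lemma partial_deriv_has_real_derivative:
  fixes f :: "'a::euclidean_space \<Rightarrow> real"
  assumes "f differentiable_on S" "open S" "x \<in> S"
  shows "((\<lambda>s. f (x + s *\<^sub>R b)) has_real_derivative partial_deriv b f x) (at 0)"
proof -
  have "f differentiable (at (x + 0 *\<^sub>R b))"
    using assms differentiable_on_eq_differentiable_at by auto
  moreover have "(\<lambda>s::real. x + s *\<^sub>R b) differentiable (at 0)"
    by (rule differentiableI[of _ "\<lambda>s. s *\<^sub>R b"]) (auto intro!: derivative_eq_intros)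
  ultimately have "(f \<circ> (\<lambda>s::real. x + s *\<^sub>R b)) differentiable (at 0)"
    by (rule differentiable_chain_at[rotated])
  then show ?thesis
    unfolding partial_deriv_def o_def
    using DERIV_imp_deriv real_differentiable_def by blast
qed

lemma second_derivative_nonneg_at_local_min:
  fixes h h' :: "real \<Rightarrow> real"
  assumes h: "\<And>s. \<bar>s\<bar> < d \<Longrightarrow> (h has_real_derivative h' s) (at s)"
    and h': "(h' has_real_derivative D) (at 0)"
    and min: "\<And>s. \<bar>s\<bar> < d \<Longrightarrow> h 0 \<le> h s" and "0 < d"
  shows "0 \<le> D"
proof (rule ccontr)
  assume "\<not> 0 \<le> D"
  then have "D < 0" by simp
  have "h' 0 = 0"
    using DERIV_local_min[OF h[of 0] \<open>0 < d\<close>] min \<open>0 < d\<close> by auto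
  with DERIV_neg_dec_right[OF h' \<open>D < 0\<close>] obtain e where
    e: "e > 0" "\<And>s. 0 < s \<Longrightarrow> s < e \<Longrightarrow> h' s < 0" by auto
  define s where "s = min d e / 2"
  have s: "0 < s" "s < d" "s < e" using e(1) \<open>0 < d\<close> by (auto simp: s_def min_def)
  have "h s < h 0"
  proof (rule DERIV_neg_imp_decreasing_open[OF s(1)])
    show "\<exists>y. (h has_real_derivative y) (at r) \<and> y < 0" if "0 < r" "r < s" for r
      using h[of r] e(2)[of r] that s by auto
    show "continuous_on {0..s} h"
      using s h by (intro DERIV_continuous_on[of _ h h'] has_field_derivative_at_within[OF h]) auto
  qed
  with min[of s] s show False by simp
qed

lemma partial_deriv_nonneg_at_min:
  fixes f :: "'a::euclidean_space \<Rightarrow> real"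
  assumes "C2_on S f" "open S" "x \<in> S" "b \<in> Basis"
    and min: "\<And>y. y \<in> S \<Longrightarrow> f x \<le> f y"
  shows "0 \<le> partial_deriv b (partial_deriv b f) x"
proof -
  obtain d where d: "0 < d" "ball x d \<subseteq> S"
    using assms(2,3) openE by blast
  have inS: "x + s *\<^sub>R b \<in> S" if "\<bar>s\<bar> < d" for s
    using that d(2) \<open>b \<in> Basis\<close> by (auto simp: dist_norm subset_iff)
  have C2: "f differentiable_on S" "partial_deriv b f differentiable_on S"
    using assms unfolding C2_on_def by auto
  show ?thesis
  proof (rule second_derivative_nonneg_at_local_min[OF _ _ _ d(1)])
    show "((\<lambda>s. f (x + s *\<^sub>R b)) has_real_derivative partial_deriv b f (x + s *\<^sub>R b)) (at s)"
      if "\<bar>s\<bar> < d" for s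
      by (rule has_real_derivative_along_line, rule partial_deriv_has_real_derivative[OF C2(1) assms(2) inS[OF that]])
    show "((\<lambda>s. partial_deriv b f (x + s *\<^sub>R b)) has_real_derivative
        partial_deriv b (partial_deriv b f) x) (at 0)"
      by (rule partial_deriv_has_real_derivative[OF C2(2) assms(2,3)])
    show "f (x + 0 *\<^sub>R b) \<le> f (x + s *\<^sub>R b)" if "\<bar>s\<bar> < d" for s
      using min[OF inS[OF that]] by simp
  qed
qed

lemma C21_on_time_derivative:
  assumes "C21_on S J u" "open J" "x \<in> S" "s \<in> J"
  shows "(u x has_real_derivative deriv (u x) s) (at s)"
proof -
  have "u x differentiable (at s)"
    using assms by (simp add: C21_on_def differentiable_on_eq_differentiable_at)
  then show ?thesis
    using DERIV_imp_deriv real_differentiable_def by blast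
qed

text \<open>
  At a negative minimum over the closed cylinder, which must lie in \<open>S\<close> at a positive time, the
  second derivatives are nonnegative and the time derivative is not positive, contrary to the strict
  inequality.
\<close>

lemma supersolution_nonneg:
  fixes u :: "'a::euclidean_space \<Rightarrow> real \<Rightarrow> real"
  assumes S: "open S" "bounded S"
    and cont: "continuous_on (closure S \<times> {0..t}) (\<lambda>(x, t). u x t)"
    and C2: "\<And>s. 0 < s \<Longrightarrow> s \<le> t \<Longrightarrow> C2_on S (\<lambda>x. u x s)"
    and dt: "\<And>x s. x \<in> S \<Longrightarrow> 0 < s \<Longrightarrow> s \<le> t \<Longrightarrow> (u x has_real_derivative ut x s) (at s)"
    and super: "\<And>x s. x \<in> S \<Longrightarrow> 0 < s \<Longrightarrow> s \<le> t \<Longrightarrow> laplacian (\<lambda>y. u y s) x < ut x s"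
    and initial: "\<And>x. x \<in> S \<Longrightarrow> 0 \<le> u x 0"
    and lateral: "\<And>x s. x \<in> frontier S \<Longrightarrow> 0 \<le> s \<Longrightarrow> s \<le> t \<Longrightarrow> 0 \<le> u x s"
    and x: "x \<in> S" "0 \<le> t"
  shows "0 \<le> u x t"
proof (rule ccontr)
  assume neg: "\<not> 0 \<le> u x t"
  have "compact (closure S \<times> {0..t})"
    using S by (intro compact_Times) auto
  moreover have xt: "(x, t) \<in> closure S \<times> {0..t}"
    using x closure_subset by auto
  moreover have "closure S \<times> {0..t} \<noteq> {}" using xt by blast
  ultimately obtain q where q: "q \<in> closure S \<times> {0..t}"
    and qmin: "\<And>z. z \<in> closure S \<times> {0..t} \<Longrightarrow> (\<lambda>(x, t). u x t) q \<le> (\<lambda>(x, t). u x t) z"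
    using continuous_attains_inf[OF _ _ cont] by blast
  obtain y s where ys: "y \<in> closure S" "0 \<le> s" "s \<le> t"
    and min: "\<And>z r. z \<in> closure S \<Longrightarrow> 0 \<le> r \<Longrightarrow> r \<le> t \<Longrightarrow> u y s \<le> u z r"
    using q qmin by (cases q) fastforce
  have uneg: "u y s < 0"
    using min[of x t] xt neg by auto
  have "y \<notin> frontier S" using lateral[of y s] uneg ys by auto
  with ys have y: "y \<in> S"
    using S by (auto simp: frontier_def interior_open)
  have "s \<noteq> 0" using initial[OF y] uneg by auto
  with ys have s: "0 < s" by simp
  have "0 \<le> laplacian (\<lambda>y. u y s) y"
    unfolding laplacian_def
  proof (intro sum_nonneg partial_deriv_nonneg_at_min[OF C2[OF s ys(3)] S(1) y])
    show "u y s \<le> u z s" if "z \<in> S" for z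
      using min that ys closure_subset by blast
  qed
  with super[OF y s ys(3)] have "0 < ut y s" by simp
  from DERIV_pos_inc_left[OF dt[OF y s ys(3)] this] obtain d where
    d: "d > 0" "\<And>h. 0 < h \<Longrightarrow> h < d \<Longrightarrow> u y (s - h) < u y s" by blast
  define h where "h = min d s / 2"
  have "0 < h" "h < d" "h < s" using d(1) s by (auto simp: h_def min_def)
  with d(2)[of h] min[OF ys(1), of "s - h"] ys(3) show False by auto
qed

section \<open>A convex cutoff\<close>

text \<open>
  A function that vanishes to second order at the origin can be continued by zero to the negative
  axis without losing its derivative at the junction.
\<close>

lemma has_real_derivative_compose_max_0:
  fixes h h' :: "real \<Rightarrow> real"
  assumes h: "\<And>r. 0 \<le> r \<Longrightarrow> (h has_real_derivative h' r) (at r)"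
    and 0: "h 0 = 0" "h' 0 = 0"
  shows "((\<lambda>s. h (max 0 s)) has_real_derivative h' (max 0 s)) (at s)"
proof -
  consider "s < 0" | "s > 0" | "s = 0" by linarith
  then show ?thesis
  proof cases
    case 1
    then have "\<forall>\<^sub>F r in nhds s. h (max 0 r) = 0"
      using 0 by (auto intro!: eventually_mono[OF eventually_nhds_in_open[of "{..<0}"]])
    then show ?thesis using 0 1 by (subst DERIV_cong_ev[OF refl _ refl, where g="\<lambda>_. 0"]) auto
  next
    case 2
    then have "\<forall>\<^sub>F r in nhds s. h (max 0 r) = h r"
      by (auto intro!: eventually_mono[OF eventually_nhds_in_open[of "{0<..}"]])
    then show ?thesis using h[of s] 2 by (subst DERIV_cong_ev[OF refl _ refl, where g=h]) auto
  next
    case 3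
    have "(\<lambda>r. \<bar>h r / r\<bar>) \<midarrow>0\<rightarrow> 0"
      using h[of 0] 0 tendsto_rabs_zero by (fastforce simp: DERIV_def)
    then have "(\<lambda>r. h (max 0 r) / r) \<midarrow>0\<rightarrow> 0"
      by (rule Lim_null_comparison[rotated]) (auto simp: max_def 0 simp del: abs_divide)
    then show ?thesis using 0 3 by (simp add: DERIV_def)
  qed
qed

text \<open>
  With \<open>r = max 0 (s - e)\<close>, the cutoff is \<open>r ^ 3 / (r + e)\<^sup>2\<close>. The cubic numerator makes it twice
  continuously differentiable across \<open>s = e\<close>; the quadratic denominator makes it asymptotically
  linear with slope 1. The next two functions are its first and second derivatives, the second of
  which is visibly nonnegative.
\<close>

definition cutoff :: "real \<Rightarrow> real \<Rightarrow> real" where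
  "cutoff e s = (max 0 (s - e)) ^ 3 / (max 0 (s - e) + e)\<^sup>2"

definition cutoff' :: "real \<Rightarrow> real \<Rightarrow> real" where
  "cutoff' e s = (max 0 (s - e))\<^sup>2 * (max 0 (s - e) + 3 * e) / (max 0 (s - e) + e) ^ 3"

definition cutoff'' :: "real \<Rightarrow> real \<Rightarrow> real" where
  "cutoff'' e s = 6 * e\<^sup>2 * max 0 (s - e) / (max 0 (s - e) + e) ^ 4"

lemma cutoff_derivative:
  assumes "0 < e"
  shows "(cutoff e has_real_derivative cutoff' e s) (at s)"
proof -
  have "((\<lambda>s. (max 0 s) ^ 3 / (max 0 s + e)\<^sup>2) has_real_derivative
      (max 0 (s + - e))\<^sup>2 * (max 0 (s + - e) + 3 * e) / (max 0 (s + - e) + e) ^ 3) (at (s + - e))"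
  proof (rule has_real_derivative_compose_max_0)
    fix r :: real assume "0 \<le> r"
    with assms have "r + e \<noteq> 0" by simp
    then show "((\<lambda>r. r ^ 3 / (r + e)\<^sup>2) has_real_derivative r\<^sup>2 * (r + 3 * e) / (r + e) ^ 3) (at r)"
      by (auto intro!: derivative_eq_intros simp: divide_simps) (simp add: power_eq_if algebra_simps)
  qed (use assms in auto)
  then show ?thesis
    unfolding DERIV_shift by (simp add: cutoff_def[abs_def] cutoff'_def)
qed

lemma cutoff'_derivative:
  assumes "0 < e"
  shows "(cutoff' e has_real_derivative cutoff'' e s) (at s)"
proof -
  have "((\<lambda>s. (max 0 s)\<^sup>2 * (max 0 s + 3 * e) / (max 0 s + e) ^ 3) has_real_derivative
      6 * e\<^sup>2 * max 0 (s + - e) / (max 0 (s + - e) + e) ^ 4) (at (s + - e))"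
  proof (rule has_real_derivative_compose_max_0)
    fix r :: real assume "0 \<le> r"
    with assms have "r + e \<noteq> 0" by simp
    then show "((\<lambda>r. r\<^sup>2 * (r + 3 * e) / (r + e) ^ 3) has_real_derivative
        6 * e\<^sup>2 * r / (r + e) ^ 4) (at r)"
      by (auto intro!: derivative_eq_intros simp: divide_simps) (simp add: power_eq_if algebra_simps)
  qed (use assms in auto)
  then show ?thesis
    unfolding DERIV_shift by (simp add: cutoff'_def[abs_def] cutoff''_def)
qed

lemma continuous_on_cutoff'': "0 < e \<Longrightarrow> continuous_on A (cutoff'' e)"
  unfolding cutoff''_def[abs_def]
  by (intro continuous_intros) (smt (verit) zero_less_power)

lemma cutoff_eq_0: "s \<le> e \<Longrightarrow> cutoff e s = 0 \<and> cutoff' e s = 0 \<and> cutoff'' e s = 0"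
  by (simp add: cutoff_def cutoff'_def cutoff''_def)

lemma cutoff_nonneg: "0 < e \<Longrightarrow> 0 \<le> cutoff e s" "0 < e \<Longrightarrow> 0 \<le> cutoff' e s" "0 < e \<Longrightarrow> 0 \<le> cutoff'' e s"
  by (simp_all add: cutoff_def cutoff'_def cutoff''_def)

lemma cutoff'_le_1:
  assumes "0 < e" shows "cutoff' e s \<le> 1"
proof -
  define r where "r = max 0 (s - e)"
  have "r\<^sup>2 * (r + 3 * e) \<le> r\<^sup>2 * (r + 3 * e) + 3 * r * e\<^sup>2 + e ^ 3"
    using assms by (simp add: r_def)
  also have "\<dots> = (r + e) ^ 3"
    by (simp add: algebra_simps power_eq_if)
  finally show ?thesis
    using assms unfolding cutoff'_def r_def[symmetric]
    by (subst divide_le_eq_1_pos) (auto simp: r_def)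
qed

lemma cutoff_le: "0 < e \<Longrightarrow> 0 \<le> s \<Longrightarrow> cutoff e s \<le> s"
proof -
  assume e: "0 < e" and s: "0 \<le> s"
  define r where "r = max 0 (s - e)"
  have r: "0 \<le> r" "r \<le> s" using e s by (auto simp: r_def)
  have "r ^ 3 \<le> r * (r + e)\<^sup>2"
    using e r by (simp add: algebra_simps power_eq_if)
  then have "r ^ 3 / (r + e)\<^sup>2 \<le> r"
    using e r by (subst divide_le_eq) (auto simp: zero_less_power)
  with r show ?thesis unfolding cutoff_def r_def[symmetric] by simp
qed

lemma cutoff_ge: "0 < e \<Longrightarrow> s - 3 * e \<le> cutoff e s"
proof -
  assume e: "0 < e"
  define r where "r = max 0 (s - e)"
  have r: "0 \<le> r" "s - e \<le> r" using e by (auto simp: r_def)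
  have "(r - 2 * e) * (r + e)\<^sup>2 \<le> r ^ 3"
    using e r by (simp add: algebra_simps power_eq_if)
  then have "r - 2 * e \<le> r ^ 3 / (r + e)\<^sup>2"
    using e r by (subst le_divide_eq) (auto simp: zero_less_power)
  with r show ?thesis unfolding cutoff_def r_def[symmetric] by simp
qed

lemma continuous_on_cutoff: "0 < e \<Longrightarrow> continuous_on A (cutoff e)" "0 < e \<Longrightarrow> continuous_on A (cutoff' e)"
  by (rule DERIV_continuous_on, rule has_field_derivative_at_within,
      erule cutoff_derivative cutoff'_derivative)+

section \<open>The weighted integral of a solution\<close>

text \<open>
  This is where the boundary condition on \<open>\<phi>\<close> enters: the composition of the cutoff with \<open>\<phi>\<close> is
  supported in this closed set, away from the boundary.
\<close>

lemma superlevel_set_inside: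
  fixes \<phi> :: "'a::euclidean_space \<Rightarrow> real"
  assumes "open S" "continuous_on (closure S) \<phi>" "\<forall>x\<in>frontier S. \<phi> x = 0" "0 < e"
  shows "closed {x \<in> closure S. e \<le> \<phi> x}" "{x \<in> closure S. e \<le> \<phi> x} \<subseteq> S"
proof -
  show "closed {x \<in> closure S. e \<le> \<phi> x}"
    using assms by (intro continuous_on_closed_Collect_le continuous_intros) auto
  show "{x \<in> closure S. e \<le> \<phi> x} \<subseteq> S"
    using assms by (force simp: frontier_def interior_open)
qed

text \<open>
  With \<open>W = 1 - (1 - v) ^ 3\<close> the integrand on the right dominates \<open>cutoff e \<phi> \<sqdot> \<Delta>W\<close>. Green's
  identity moves the Laplacian onto the cutoff, and
  \<open>\<Delta>(cutoff e \<phi>) = cutoff'' \<bar>\<nabla>\<phi>\<bar>\<^sup>2 + cutoff' \<Delta>\<phi>\<close>. The first term is discarded by convexity;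
  the second is at least \<open>- \<bar>\<Delta>\<phi>\<bar>\<close> after multiplication by \<open>W\<close>, because \<open>W\<close> and the slope both
  lie in \<open>[0, 1]\<close>.
\<close>

lemma weighted_laplacian_lower_bound:
  fixes \<phi> v :: "'a::euclidean_space \<Rightarrow> real"
  assumes S: "open S" "bounded S"
    and \<phi>: "C2_on S \<phi>" "continuous_on (closure S) \<phi>" "\<forall>x\<in>frontier S. \<phi> x = 0"
      "(\<lambda>x. \<bar>laplacian \<phi> x\<bar>) integrable_on S"
    and v: "C2_on S v" "\<And>x. x \<in> S \<Longrightarrow> 0 \<le> v x \<and> v x < 1"
    and e: "0 < e"
  shows "- integral S (\<lambda>x. \<bar>laplacian \<phi> x\<bar>)
    \<le> integral S (\<lambda>x. cutoff e (\<phi> x) * (3 * (1 - v x)\<^sup>2 * laplacian v x))"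
proof -
  define K where "K = {x \<in> closure S. e \<le> \<phi> x}"
  have K: "closed K" "K \<subseteq> S"
    unfolding K_def using superlevel_set_inside[OF S(1) \<phi>(2,3) e] by auto
  have off: "\<phi> x \<le> e" if "x \<in> S - K" for x
    using that closure_subset[of S] by (auto simp: K_def)
  have C2D: "f differentiable_on S" "partial_deriv b f differentiable_on S"
    "continuous_on S f" "continuous_on S (partial_deriv b f)"
    "continuous_on S (partial_deriv b (partial_deriv b f))"
    if "C2_on S f" "b \<in> Basis" for f b
    using that by (auto simp: C2_on_def differentiable_imp_continuous_on)
  note D = C2D[OF \<phi>(1)] C2D[OF v(1)]
  have cont0: "continuous_on S \<phi>" "continuous_on S v"
    using \<phi>(1) v(1) by (auto simp: C2_on_def differentiable_imp_continuous_on)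
  \<comment> \<open>\<open>?p2 b\<close> and \<open>?w2 b\<close> are the second derivatives of \<open>?p\<close> and \<open>?w\<close> in direction \<open>b\<close>.\<close>
  let ?p = "\<lambda>x. cutoff e (\<phi> x)"
  let ?p2 = "\<lambda>b x. cutoff'' e (\<phi> x) * (partial_deriv b \<phi> x)\<^sup>2
      + cutoff' e (\<phi> x) * partial_deriv b (partial_deriv b \<phi>) x"
  let ?w = "\<lambda>x. 1 - (1 - v x) ^ 3"
  let ?w2 = "\<lambda>b x. 3 * (1 - v x)\<^sup>2 * partial_deriv b (partial_deriv b v) x
      - 6 * (1 - v x) * (partial_deriv b v x)\<^sup>2"
  note cc = continuous_on_compose2[OF continuous_on_cutoff(1)[OF e, of UNIV]]
    continuous_on_compose2[OF continuous_on_cutoff(2)[OF e, of UNIV]]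
    continuous_on_compose2[OF continuous_on_cutoff''[OF e, of UNIV]]
  note int = integrable_on_compact_support[OF S(1) K S(2)]
  have int_pw: "(\<lambda>x. ?p x * ?w2 b x) integrable_on S"
    and int_wp: "(\<lambda>x. ?w x * ?p2 b x) integrable_on S" if b: "b \<in> Basis" for b
    by (rule int; use off cutoff_eq_0 in \<open>force intro!: continuous_intros cc cont0 D[OF b]\<close>)+
  have swap: "integral S (\<lambda>x. ?p x * ?w2 b x) = integral S (\<lambda>x. ?w x * ?p2 b x)"
    if b: "b \<in> Basis" for b
  proof (rule integral_second_derivative_swap[OF S(1) K S(2)])
    fix x assume x: "x \<in> S"
    note pd = D(1,2,6,7)[OF b, THEN partial_deriv_has_real_derivative[OF _ S(1) x]]
    have c1: "(cutoff e has_real_derivative cutoff' e (\<phi> (x + 0 *\<^sub>R b))) (at (\<phi> (x + 0 *\<^sub>R b)))"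
      "(cutoff' e has_real_derivative cutoff'' e (\<phi> (x + 0 *\<^sub>R b))) (at (\<phi> (x + 0 *\<^sub>R b)))"
      by (rule cutoff_derivative[OF e] cutoff'_derivative[OF e])+
    show "((\<lambda>s. cutoff e (\<phi> (x + s *\<^sub>R b))) has_real_derivative
        cutoff' e (\<phi> x) * partial_deriv b \<phi> x) (at 0)"
      using DERIV_chain2[OF c1(1) pd(1)] by simp
    show "((\<lambda>s. cutoff' e (\<phi> (x + s *\<^sub>R b)) * partial_deriv b \<phi> (x + s *\<^sub>R b))
        has_real_derivative ?p2 b x) (at 0)"
      using DERIV_mult[OF DERIV_chain2[OF c1(2) pd(1)] pd(2)]
      by (simp add: power2_eq_square algebra_simps)
    show "((\<lambda>s. 1 - (1 - v (x + s *\<^sub>R b)) ^ 3) has_real_derivative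
        3 * (1 - v x)\<^sup>2 * partial_deriv b v x) (at 0)"
      by (auto intro!: derivative_eq_intros pd)
    show "((\<lambda>s. 3 * (1 - v (x + s *\<^sub>R b))\<^sup>2 * partial_deriv b v (x + s *\<^sub>R b))
        has_real_derivative ?w2 b x) (at 0)"
      by (auto intro!: derivative_eq_intros pd simp: power2_eq_square algebra_simps)
  next
    fix x assume "x \<in> S - K"
    then show "?p x = 0 \<and> cutoff' e (\<phi> x) * partial_deriv b \<phi> x = 0 \<and> ?p2 b x = 0"
      using cutoff_eq_0[OF off] by simp
  qed (force intro!: continuous_intros cc cont0 D[OF b])+
  have "- integral S (\<lambda>x. \<bar>laplacian \<phi> x\<bar>) = integral S (\<lambda>x. - \<bar>laplacian \<phi> x\<bar>)"
    by simp
  also have "\<dots> \<le> integral S (\<lambda>x. \<Sum>b\<in>Basis. ?w x * ?p2 b x)"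
  proof (rule integral_le)
    show "(\<lambda>x. \<Sum>b\<in>Basis. ?w x * ?p2 b x) integrable_on S"
      by (intro integrable_sum int_wp) auto
    fix x assume x: "x \<in> S"
    have w: "0 \<le> ?w x" "?w x \<le> 1"
      using v(2)[OF x] power_le_one[of "1 - v x" 3] by auto
    let ?c = "?w x * cutoff' e (\<phi> x)"
    have c: "0 \<le> ?c" "?c \<le> 1"
      using mult_nonneg_nonneg[OF w(1) cutoff_nonneg(2)[OF e]]
        mult_le_one[OF w(2) cutoff_nonneg(2)[OF e] cutoff'_le_1[OF e]] by blast+
    have minus_abs_le: "- \<bar>laplacian \<phi> x\<bar> \<le> laplacian \<phi> x" by simp
    have "- \<bar>laplacian \<phi> x\<bar> \<le> - (?c * \<bar>laplacian \<phi> x\<bar>)"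
      using mult_right_mono[OF c(2), of "\<bar>laplacian \<phi> x\<bar>"] by simp
    also have "\<dots> \<le> ?c * laplacian \<phi> x"
      using mult_left_mono[OF minus_abs_le c(1)] by simp
    also have "\<dots> = (\<Sum>b\<in>Basis. ?c * partial_deriv b (partial_deriv b \<phi>) x)"
      by (simp add: laplacian_def sum_distrib_left)
    also have "\<dots> \<le> (\<Sum>b\<in>Basis. ?w x * ?p2 b x)"
      using w cutoff_nonneg(3)[OF e] by (intro sum_mono) (simp add: distrib_left mult.assoc)
    finally show "- \<bar>laplacian \<phi> x\<bar> \<le> (\<Sum>b\<in>Basis. ?w x * ?p2 b x)" .
  qed (use \<phi>(4) in \<open>rule integrable_neg\<close>)
  also have "\<dots> = (\<Sum>b\<in>Basis. integral S (\<lambda>x. ?w x * ?p2 b x))"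
    by (rule integral_sum) (auto intro: int_wp)
  also have "\<dots> = (\<Sum>b\<in>Basis. integral S (\<lambda>x. ?p x * ?w2 b x))"
    by (intro sum.cong refl swap[symmetric])
  also have "\<dots> = integral S (\<lambda>x. \<Sum>b\<in>Basis. ?p x * ?w2 b x)"
    by (rule integral_sum[symmetric]) (rule finite_Basis, rule int_pw)
  also have "\<dots> \<le> integral S (\<lambda>x. ?p x * (3 * (1 - v x)\<^sup>2 * laplacian v x))"
  proof (rule integral_le)
    show "(\<lambda>x. \<Sum>b\<in>Basis. ?p x * ?w2 b x) integrable_on S"
      by (intro integrable_sum int_pw) auto
    show "(\<lambda>x. ?p x * (3 * (1 - v x)\<^sup>2 * laplacian v x)) integrable_on S"
      unfolding laplacian_def
      by (rule int; use off cutoff_eq_0 in \<open>force intro!: continuous_intros cc cont0 D\<close>)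
    fix x assume x: "x \<in> S"
    have "(\<Sum>b\<in>Basis. ?p x * ?w2 b x)
        \<le> (\<Sum>b\<in>Basis. ?p x * (3 * (1 - v x)\<^sup>2 * partial_deriv b (partial_deriv b v) x))"
      using v(2)[OF x] cutoff_nonneg(1)[OF e] by (intro sum_mono mult_left_mono) auto
    then show "(\<Sum>b\<in>Basis. ?p x * ?w2 b x) \<le> ?p x * (3 * (1 - v x)\<^sup>2 * laplacian v x)"
      by (simp add: laplacian_def sum_distrib_left)
  qed
  finally show ?thesis .
qed

text \<open>
  The functional \<open>F(s) = \<integral> cutoff e \<phi> \<sqdot> (1 - (1 - u) ^ 3)\<close> takes values between 0 and
  \<open>\<integral> cutoff e \<phi>\<close>, while its derivative is bounded below by a constant. The hypothesis \<open>super\<close> is the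
  differential inequality left of the equation once its singular denominator is cleared.
\<close>

lemma time_bound_cutoff:
  fixes \<phi> :: "'a::euclidean_space \<Rightarrow> real" and u :: "'a \<Rightarrow> real \<Rightarrow> real"
  assumes S: "open S" "bounded S"
    and \<phi>: "C2_on S \<phi>" "continuous_on (closure S) \<phi>" "\<forall>x\<in>frontier S. \<phi> x = 0"
      "(\<lambda>x. \<bar>laplacian \<phi> x\<bar>) integrable_on S"
    and J: "open J" "convex J" "{0<..t} \<subseteq> J"
    and u: "C21_on S J u" "continuous_on (S \<times> J) (\<lambda>(x, s). u x s)"
      "\<And>x s. x \<in> S \<Longrightarrow> s \<in> J \<Longrightarrow> 0 \<le> u x s \<and> u x s < 1"
    and super: "\<And>x s. x \<in> S \<Longrightarrow> s \<in> J \<Longrightarrow>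
        lam \<le> (1 - u x s)\<^sup>2 * (deriv (u x) s - laplacian (\<lambda>y. u y s) x)"
    and e: "0 < e" and t: "0 < t"
  shows "t * (3 * lam * integral S (\<lambda>x. cutoff e (\<phi> x)) - integral S (\<lambda>x. \<bar>laplacian \<phi> x\<bar>))
    \<le> integral S (\<lambda>x. cutoff e (\<phi> x))"
proof -
  define K where "K = {x \<in> closure S. e \<le> \<phi> x}"
  have K: "closed K" "K \<subseteq> S"
    unfolding K_def using superlevel_set_inside[OF S(1) \<phi>(2,3) e] by auto
  have off: "cutoff e (\<phi> x) = 0" if "x \<in> S - K" for x
    using that closure_subset[of S] cutoff_eq_0 by (auto simp: K_def)
  have "continuous_on S \<phi>"
    using \<phi>(1) by (auto simp: C2_on_def differentiable_imp_continuous_on)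
  then have p: "continuous_on S (\<lambda>x. cutoff e (\<phi> x))"
    by (rule continuous_on_compose2[OF continuous_on_cutoff(1)[OF e, of UNIV]]) auto
  note int = integrable_on_compact_support[OF S(1) K S(2)]
  have C2: "C2_on S (\<lambda>x. u x s)" if "s \<in> J" for s
    using u(1) that by (simp add: C21_on_def)
  have us: "continuous_on S (\<lambda>x. u x s)" if "s \<in> J" for s
    using C2[OF that] by (auto simp: C2_on_def differentiable_imp_continuous_on)
  have lap: "continuous_on S (laplacian (\<lambda>x. u x s))" if "s \<in> J" for s
    unfolding laplacian_def[abs_def] using C2[OF that] by (intro continuous_on_sum) (auto simp: C2_on_def)
  have ut: "continuous_on (S \<times> J) (\<lambda>(x, s). deriv (u x) s)"
    using u(1) by (simp add: C21_on_def)
  have uts: "continuous_on S (\<lambda>x. deriv (u x) s)" if "s \<in> J" for s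
    using continuous_on_compose2[OF ut, of S "\<lambda>x. (x, s)"] that
    by (auto simp: continuous_on_Pair)
  let ?F = "\<lambda>s. integral S (\<lambda>x. cutoff e (\<phi> x) * (1 - (1 - u x s) ^ 3))"
  let ?F' = "\<lambda>s. integral S (\<lambda>x. cutoff e (\<phi> x) * (3 * (1 - u x s)\<^sup>2 * deriv (u x) s))"
  let ?P = "integral S (\<lambda>x. cutoff e (\<phi> x))"
  let ?L = "integral S (\<lambda>x. \<bar>laplacian \<phi> x\<bar>)"
  have F: "(?F has_real_derivative ?F' s) (at s)" if s: "s \<in> J" for s
  proof (rule integral_has_real_derivative_compact_support[OF S(1) K S(2) J(1,2) s])
    show "((\<lambda>s. cutoff e (\<phi> x) * (1 - (1 - u x s) ^ 3)) has_real_derivative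
        cutoff e (\<phi> x) * (3 * (1 - u x s)\<^sup>2 * deriv (u x) s)) (at s)"
      if "x \<in> S" "s \<in> J" for x s
      using C21_on_time_derivative[OF u(1) J(1) that] by (auto intro!: derivative_eq_intros)
    show "continuous_on (J \<times> S)
        (\<lambda>(s, x). cutoff e (\<phi> x) * (3 * (1 - u x s)\<^sup>2 * deriv (u x) s))"
    proof -
      have swap: "continuous_on (J \<times> S) (\<lambda>z. (snd z, fst z))" "(\<lambda>z. (snd z, fst z)) ` (J \<times> S) \<subseteq> S \<times> J"
        by (auto intro!: continuous_intros)
      have "continuous_on (J \<times> S) (\<lambda>z. u (snd z) (fst z))"
        "continuous_on (J \<times> S) (\<lambda>z. deriv (u (snd z)) (fst z))"
        using continuous_on_compose2[OF u(2) swap] continuous_on_compose2[OF ut swap]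
        by simp_all
      moreover have "continuous_on (J \<times> S) (\<lambda>z. cutoff e (\<phi> (snd z)))"
        by (rule continuous_on_compose2[OF p]) (auto intro!: continuous_intros)
      ultimately show ?thesis
        unfolding split_beta by (intro continuous_intros)
    qed
  qed (auto simp: off intro!: continuous_intros p us)
  have F': "3 * lam * ?P - ?L \<le> ?F' s" if s: "s \<in> J" for s
  proof -
    have intP: "(\<lambda>x. 3 * lam * cutoff e (\<phi> x)) integrable_on S"
      by (rule int) (auto simp: off intro!: continuous_intros p)
    have intL: "(\<lambda>x. cutoff e (\<phi> x) * (3 * (1 - u x s)\<^sup>2 * laplacian (\<lambda>x. u x s) x)) integrable_on S"
      by (rule int) (auto simp: off intro!: continuous_intros p us[OF s] lap[OF s])
    have "3 * lam * ?P - ?L \<le> integral S (\<lambda>x. 3 * lam * cutoff e (\<phi> x))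
        + integral S (\<lambda>x. cutoff e (\<phi> x) * (3 * (1 - u x s)\<^sup>2 * laplacian (\<lambda>x. u x s) x))"
      using weighted_laplacian_lower_bound[OF S \<phi> C2[OF s] u(3)[OF _ s] e] by simp
    also have "\<dots> = integral S (\<lambda>x. 3 * lam * cutoff e (\<phi> x)
        + cutoff e (\<phi> x) * (3 * (1 - u x s)\<^sup>2 * laplacian (\<lambda>x. u x s) x))"
      using intP intL by (rule Henstock_Kurzweil_Integration.integral_add[symmetric])
    also have "\<dots> \<le> ?F' s"
    proof (rule integral_le)
      show "(\<lambda>x. cutoff e (\<phi> x) * (3 * (1 - u x s)\<^sup>2 * deriv (u x) s)) integrable_on S"
        by (rule int) (auto simp: off intro!: continuous_intros p us[OF s] uts[OF s])
      show "3 * lam * cutoff e (\<phi> x) + cutoff e (\<phi> x) * (3 * (1 - u x s)\<^sup>2 * laplacian (\<lambda>x. u x s) x)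
          \<le> cutoff e (\<phi> x) * (3 * (1 - u x s)\<^sup>2 * deriv (u x) s)" if "x \<in> S" for x
        using mult_left_mono[OF super[OF that s] cutoff_nonneg(1)[OF e, of "\<phi> x"]]
        by (simp add: algebra_simps)
    qed (use intP intL in \<open>rule integrable_add\<close>)
    finally show ?thesis .
  qed
  have W: "0 \<le> 1 - (1 - u x s) ^ 3" "1 - (1 - u x s) ^ 3 \<le> 1" if "x \<in> S" "s \<in> J" for x s
    using u(3)[OF that] power_le_one[of "1 - u x s" 3] by auto
  have tJ: "t \<in> J" using t J by auto
  \<comment> \<open>Starting at \<open>s > 0\<close> and using only \<open>F s \<ge> 0\<close> avoids any regularity of \<open>F\<close> at time 0.\<close>
  have "(t - s) * (3 * lam * ?P - ?L) \<le> ?P" if s: "0 < s" "s < t" for s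
  proof -
    have J': "r \<in> J" if "s \<le> r" "r \<le> t" for r
      using that s J(3) by auto
    obtain z where z: "s < z" "z < t" "?F t - ?F s = (t - s) * ?F' z"
      using MVT2[OF s(2) F[OF J']] by blast
    have "(t - s) * (3 * lam * ?P - ?L) \<le> (t - s) * ?F' z"
      using F'[OF J'[of z]] z s by (intro mult_left_mono) auto
    also have "\<dots> = ?F t - ?F s" using z by simp
    also have "\<dots> \<le> ?F t"
    proof -
      have "0 \<le> ?F s"
      proof (rule Henstock_Kurzweil_Integration.integral_nonneg)
        show "(\<lambda>x. cutoff e (\<phi> x) * (1 - (1 - u x s) ^ 3)) integrable_on S"
          using us[OF J'[of s]] s by (intro int) (auto simp: off intro!: continuous_intros p)
        show "0 \<le> cutoff e (\<phi> x) * (1 - (1 - u x s) ^ 3)" if "x \<in> S" for x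
          using W(1)[OF that J'[of s]] s cutoff_nonneg(1)[OF e] by (intro mult_nonneg_nonneg) auto
      qed
      then show ?thesis by simp
    qed
    also have "\<dots> \<le> ?P"
    proof (rule integral_le)
      show "cutoff e (\<phi> x) * (1 - (1 - u x t) ^ 3) \<le> cutoff e (\<phi> x)" if "x \<in> S" for x
        using mult_left_mono[OF W(2)[OF that tJ] cutoff_nonneg(1)[OF e]] by simp
    qed (rule int; auto simp: off intro!: continuous_intros p us[OF tJ])+
    finally show ?thesis .
  qed
  then have "\<forall>\<^sub>F s in at_right 0. (t - s) * (3 * lam * ?P - ?L) \<le> ?P"
    using t by (auto simp: eventually_at_right)
  moreover have "((\<lambda>s. (t - s) * (3 * lam * ?P - ?L)) \<longlongrightarrow> (t - 0) * (3 * lam * ?P - ?L)) (at_right 0)"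
    by (intro tendsto_intros)
  ultimately have "(t - 0) * (3 * lam * ?P - ?L) \<le> ?P"
    by (intro tendsto_upperbound) auto
  then show ?thesis by simp
qed

section \<open>Norms and the limit of the cutoff\<close>

lemma set_integrable_abs_if_extends_continuously:
  assumes "open S" "bounded S" "extends_continuously S f"
  shows "set_integrable lborel S (\<lambda>x. \<bar>f x\<bar>)"
proof -
  obtain g where g: "continuous_on (closure S) g" "\<And>x. x \<in> S \<Longrightarrow> g x = f x"
    using assms(3) by (auto simp: extends_continuously_def)
  have "set_integrable lborel (closure S) (\<lambda>x. \<bar>g x\<bar>)"
    unfolding set_integrable_def
    using assms(2) g(1) by (intro borel_integrable_compact continuous_intros) auto
  then have "set_integrable lborel S (\<lambda>x. \<bar>g x\<bar>)"
    using assms(1) closure_subset by (rule_tac set_integrable_subset) auto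
  moreover have "(\<lambda>x. indicator S x *\<^sub>R \<bar>g x\<bar>) = (\<lambda>x. indicator S x *\<^sub>R \<bar>f x\<bar>)"
    using g(2) by (auto simp: indicator_def)
  ultimately show ?thesis by (simp only: set_integrable_def)
qed

lemma extends_continuously_laplacian:
  assumes "C2_on_closure S f"
  shows "extends_continuously S (laplacian f)"
proof -
  have "\<forall>b\<in>Basis. \<exists>g. continuous_on (closure S) g \<and> (\<forall>x\<in>S. g x = partial_deriv b (partial_deriv b f) x)"
    using assms by (auto simp: C2_on_closure_def extends_continuously_def)
  then obtain g where g: "\<And>b. b \<in> Basis \<Longrightarrow> continuous_on (closure S) (g b)"
    "\<And>b x. b \<in> Basis \<Longrightarrow> x \<in> S \<Longrightarrow> g b x = partial_deriv b (partial_deriv b f) x"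
    by metis
  have "continuous_on (closure S) (\<lambda>x. \<Sum>b\<in>Basis. g b x)"
    using g(1) by (intro continuous_on_sum)
  moreover have "\<forall>x\<in>S. (\<Sum>b\<in>Basis. g b x) = laplacian f x"
    using g(2) by (simp add: laplacian_def)
  ultimately show ?thesis unfolding extends_continuously_def by blast
qed

lemma integral_pos_continuous:
  fixes f :: "'a::euclidean_space \<Rightarrow> real"
  assumes S: "open S" and f: "continuous_on S f" "f integrable_on S" "\<And>x. x \<in> S \<Longrightarrow> 0 \<le> f x"
    and x: "x \<in> S" "0 < f x"
  shows "0 < integral S f"
proof -
  have "open (S \<inter> f -` {f x / 2<..})"
    using f(1) S by (rule continuous_open_preimage) auto
  moreover have "x \<in> S \<inter> f -` {f x / 2<..}" using x by simp
  ultimately obtain a b where ab: "x \<in> box a b" "cbox a b \<subseteq> S \<inter> f -` {f x / 2<..}"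
    using open_contains_cbox[of "S \<inter> f -` {f x / 2<..}" x] by metis
  have int: "f integrable_on cbox a b"
    using ab(2) by (intro integrable_continuous continuous_on_subset[OF f(1)]) auto
  have "0 < measure lborel (cbox a b) * (f x / 2)"
    using x ab(1) by (intro mult_pos_pos) (auto simp: content_pos_lt_eq mem_box intro: less_trans)
  also have "\<dots> = integral (cbox a b) (\<lambda>_. f x / 2)" by simp
  also have "\<dots> \<le> integral (cbox a b) f"
    using ab(2) int by (intro integral_le) (auto intro: less_imp_le)
  also have "\<dots> \<le> integral S f"
    using ab(2) int f by (intro integral_subset_le) auto
  finally show ?thesis .
qed

lemma abs_less_1_before_quenching:
  assumes "0 \<le> s" "ereal s < quenching_time \<Omega> u" "x \<in> \<Omega>"
  shows "\<bar>u x s\<bar> < 1"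
proof -
  obtain t where t: "s < t" "\<forall>\<tau>\<in>{0..t}. sup_norm_on \<Omega> (\<lambda>x. u x \<tau>) < 1"
    using assms(2) by (auto simp: quenching_time_def less_Sup_iff)
  have "ereal \<bar>u x s\<bar> \<le> sup_norm_on \<Omega> (\<lambda>x. u x s)"
    unfolding sup_norm_on_def by (rule SUP_upper) fact
  also have "\<dots> < 1" using t assms(1) by auto
  finally show ?thesis by simp
qed

text \<open>
  Stated for real times below the quenching time, so that an infinite quenching time is covered, and
  without division, so that the bracket may have any sign.
\<close>

lemma quenching_time_bound:
  fixes \<Omega> :: "'a::euclidean_space set" and \<phi> :: "'a \<Rightarrow> real"
  assumes \<Omega>: "open \<Omega>" "bounded \<Omega>" and "0 < \<delta>" "0 < lam"
    and \<phi>: "C2_on_closure \<Omega> \<phi>" "\<forall>x\<in>closure \<Omega>. 0 \<le> \<phi> x" "\<forall>x\<in>frontier \<Omega>. \<phi> x = 0"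
    and u: "solves_F \<Omega> lam \<delta> (quenching_time \<Omega> u) u"
    and t: "0 < t" "ereal t < quenching_time \<Omega> u"
  shows "t * (3 * lam * L1_norm_on \<Omega> \<phi> - L1_norm_on \<Omega> (laplacian \<phi>)) \<le> L1_norm_on \<Omega> \<phi>"
proof -
  let ?T = "quenching_time \<Omega> u"
  define J where "J = {s. 0 < s \<and> ereal s < ?T}"
  have J: "open J" "convex J" "{0<..t} \<subseteq> J"
  proof -
    show "open J" unfolding J_def
      by (intro open_Collect_conj open_Collect_less continuous_intros continuous_on_ereal)
    show "convex J"
      unfolding is_interval_convex_1[symmetric] is_interval_1 J_def
      by (auto intro: le_less_trans[of "ereal _" "ereal _"])
    show "{0<..t} \<subseteq> J"
      using t by (auto simp: J_def intro: le_less_trans[of "ereal _" "ereal _"])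
  qed
  have cont: "continuous_on (closure \<Omega> \<times> {s. 0 \<le> s \<and> ereal s < ?T}) (\<lambda>(x, s). u x s)"
    and C21: "C21_on \<Omega> J u"
    and eq: "\<And>x s. x \<in> \<Omega> \<Longrightarrow> s \<in> J \<Longrightarrow> deriv (u x) s - laplacian (\<lambda>y. u y s) x
          = lam * ((1 + \<delta> * (norm (grad (\<lambda>y. u y s) x))\<^sup>2) / (1 - u x s)\<^sup>2)"
    and lateral: "\<And>x s. x \<in> frontier \<Omega> \<Longrightarrow> 0 \<le> s \<Longrightarrow> ereal s < ?T \<Longrightarrow> u x s = 0"
    and initial: "\<And>x. x \<in> \<Omega> \<Longrightarrow> u x 0 = 0"
    using u by (auto simp: solves_F_def J_def)
  have u1: "\<bar>u x s\<bar> < 1" if "x \<in> \<Omega>" "s \<in> J" for x s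
    using that abs_less_1_before_quenching[of s \<Omega> u x] by (auto simp: J_def)
  have super: "lam \<le> (1 - u x s)\<^sup>2 * (deriv (u x) s - laplacian (\<lambda>y. u y s) x)"
    if "x \<in> \<Omega>" "s \<in> J" for x s
  proof -
    have "1 - u x s \<noteq> 0" using u1[OF that] by auto
    then have "(1 - u x s)\<^sup>2 * (deriv (u x) s - laplacian (\<lambda>y. u y s) x)
        = lam * (1 + \<delta> * (norm (grad (\<lambda>y. u y s) x))\<^sup>2)"
      unfolding eq[OF that] by simp
    also have "\<dots> \<ge> lam"
      using \<open>0 < lam\<close> \<open>0 < \<delta>\<close> by (simp add: mult_le_cancel_left1)
    finally show ?thesis .
  qed
  have u0: "0 \<le> u x s" if xs: "x \<in> \<Omega>" "s \<in> J" for x s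
  proof (rule supersolution_nonneg[OF \<Omega>, where u = u and x = x and t = s and ut = "\<lambda>x s. deriv (u x) s"])
    have below: "ereal r < ?T" if "r \<le> s" for r
      using that xs by (auto simp: J_def intro: le_less_trans[of "ereal _" "ereal _"])
    have inJ: "r \<in> J" if "0 < r" "r \<le> s" for r
      using that below by (auto simp: J_def)
    show "continuous_on (closure \<Omega> \<times> {0..s}) (\<lambda>(x, t). u x t)"
      using below by (intro continuous_on_subset[OF cont]) auto
    show "C2_on \<Omega> (\<lambda>x. u x r)" if "0 < r" "r \<le> s" for r
      using C21 inJ[OF that] by (simp add: C21_on_def)
    show "(u x has_real_derivative deriv (u x) r) (at r)" if "x \<in> \<Omega>" "0 < r" "r \<le> s" for x r
      using that inJ by (intro C21_on_time_derivative[OF C21 J(1)])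
    show "laplacian (\<lambda>y. u y r) x < deriv (u x) r" if "x \<in> \<Omega>" "0 < r" "r \<le> s" for x r
    proof -
      have "0 < (1 - u x r)\<^sup>2 * (deriv (u x) r - laplacian (\<lambda>y. u y r) x)"
        using super[OF that(1) inJ[OF that(2,3)]] \<open>0 < lam\<close> by linarith
      then show ?thesis by (simp add: zero_less_mult_iff)
    qed
    show "0 \<le> u x r" if "x \<in> frontier \<Omega>" "0 \<le> r" "r \<le> s" for x r
      using lateral[OF that(1,2) below[OF that(3)]] by simp
  qed (use xs initial in \<open>auto simp: J_def\<close>)
  have \<phi>C: "C2_on \<Omega> \<phi>" "continuous_on (closure \<Omega>) \<phi>" "extends_continuously \<Omega> \<phi>"
    using \<phi>(1) by (auto simp: C2_on_closure_def extends_continuously_def)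
  note int\<phi> = set_integrable_abs_if_extends_continuously[OF \<Omega> \<phi>C(3), THEN set_borel_integral_eq_integral(1)]
    and intL = set_integrable_abs_if_extends_continuously[OF \<Omega> extends_continuously_laplacian[OF \<phi>(1)], THEN set_borel_integral_eq_integral(1)]
  have norm\<phi>: "L1_norm_on \<Omega> \<phi> = integral \<Omega> \<phi>"
    and int\<phi>': "\<phi> integrable_on \<Omega>"
  proof -
    have abs: "\<bar>\<phi> x\<bar> = \<phi> x" if "x \<in> \<Omega>" for x
      using \<phi>(2) that closure_subset by fastforce
    show "L1_norm_on \<Omega> \<phi> = integral \<Omega> \<phi>"
      unfolding L1_norm_on_def
      using set_borel_integral_eq_integral(2)[OF set_integrable_abs_if_extends_continuously[OF \<Omega> \<phi>C(3)]]
      by (simp add: abs cong: Henstock_Kurzweil_Integration.integral_cong)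
    show "\<phi> integrable_on \<Omega>"
      using integrable_cong[of \<Omega> "\<lambda>x. \<bar>\<phi> x\<bar>" \<phi>] int\<phi> abs by auto
  qed
  have normL: "L1_norm_on \<Omega> (laplacian \<phi>) = integral \<Omega> (\<lambda>x. \<bar>laplacian \<phi> x\<bar>)"
    unfolding L1_norm_on_def
    by (rule set_borel_integral_eq_integral(2)[OF set_integrable_abs_if_extends_continuously[OF \<Omega> extends_continuously_laplacian[OF \<phi>(1)]]])
  let ?P = "integral \<Omega> \<phi>" and ?L = "integral \<Omega> (\<lambda>x. \<bar>laplacian \<phi> x\<bar>)" and ?M = "integral \<Omega> (\<lambda>x. 1::real)"
  have const: "(\<lambda>x. c::real) integrable_on \<Omega>" for c
    using \<Omega> by (intro integrable_on_const lmeasurable_open)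
  \<comment> \<open>The cutoff lowers \<open>\<phi>\<close> by at most \<open>3 e\<close>, and the domain has finite volume \<open>?M\<close>.\<close>
  have bound: "t * (3 * lam * (?P - 3 * e * ?M) - ?L) \<le> ?P" if e: "0 < e" for e
  proof -
    let ?Pe = "integral \<Omega> (\<lambda>x. cutoff e (\<phi> x))"
    have intc: "(\<lambda>x. cutoff e (\<phi> x)) integrable_on \<Omega>"
    proof (rule integrable_on_compact_support[OF \<Omega>(1) superlevel_set_inside[OF \<Omega>(1) \<phi>C(2) \<phi>(3) e] \<Omega>(2)])
      show "continuous_on \<Omega> (\<lambda>x. cutoff e (\<phi> x))"
        by (rule continuous_on_compose2[OF continuous_on_cutoff(1)[OF e, of UNIV]
            continuous_on_subset[OF \<phi>C(2) closure_subset]]) auto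
      show "cutoff e (\<phi> x) = 0" if "x \<in> \<Omega> - {x \<in> closure \<Omega>. e \<le> \<phi> x}" for x
        using that closure_subset[of \<Omega>] cutoff_eq_0 by auto
    qed
    have "?P - 3 * e * ?M = integral \<Omega> (\<lambda>x. \<phi> x - 3 * e * 1)"
      using Henstock_Kurzweil_Integration.integral_diff[OF int\<phi>' const[of "3 * e * 1"]]
      by (simp only: Henstock_Kurzweil_Integration.integral_mult_right)
    also have "\<dots> \<le> ?Pe"
      using int\<phi>' const intc cutoff_ge[OF e] by (intro integral_le integrable_diff) auto
    finally have lower: "?P - 3 * e * ?M \<le> ?Pe" .
    have upper: "?Pe \<le> ?P"
      using cutoff_le[OF e] \<phi>(2) closure_subset[of \<Omega>] by (intro integral_le intc int\<phi>') auto
    have "t * (3 * lam * (?P - 3 * e * ?M) - ?L) \<le> t * (3 * lam * ?Pe - ?L)"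
      using lower t(1) \<open>0 < lam\<close> by (intro mult_left_mono diff_right_mono) auto
    also have "\<dots> \<le> ?Pe"
    proof (rule time_bound_cutoff[OF \<Omega> \<phi>C(1,2) \<phi>(3) intL J C21 _ _ super e t(1)])
      show "continuous_on (\<Omega> \<times> J) (\<lambda>(x, s). u x s)"
        using closure_subset[of \<Omega>] by (intro continuous_on_subset[OF cont]) (auto simp: J_def)
      show "0 \<le> u x s \<and> u x s < 1" if "x \<in> \<Omega>" "s \<in> J" for x s
        using u0[OF that] u1[OF that] by auto
    qed
    finally show ?thesis using upper by linarith
  qed
  have "\<forall>\<^sub>F e in at_right 0. t * (3 * lam * (?P - 3 * e * ?M) - ?L) \<le> ?P"
    using bound by (auto simp: eventually_at_right_less intro: eventually_mono[OF eventually_at_right_less])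
  moreover have "((\<lambda>e. t * (3 * lam * (?P - 3 * e * ?M) - ?L)) \<longlongrightarrow>
      t * (3 * lam * (?P - 3 * 0 * ?M) - ?L)) (at_right 0)"
    by (intro tendsto_intros)
  ultimately have "t * (3 * lam * (?P - 3 * 0 * ?M) - ?L) \<le> ?P"
    by (intro tendsto_upperbound) auto
  then show ?thesis by (simp add: norm\<phi> normL)
qed

lemma L1_norm_on_pos:
  assumes "open \<Omega>" "bounded \<Omega>" "continuous_on (closure \<Omega>) \<phi>" "x \<in> \<Omega>" "\<phi> x \<noteq> 0"
  shows "0 < L1_norm_on \<Omega> \<phi>"
proof -
  have int: "set_integrable lborel \<Omega> (\<lambda>x. \<bar>\<phi> x\<bar>)"
    using assms by (intro set_integrable_abs_if_extends_continuously) (auto simp: extends_continuously_def)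
  have "0 < integral \<Omega> (\<lambda>x. \<bar>\<phi> x\<bar>)"
    using assms closure_subset
    by (intro integral_pos_continuous[OF assms(1) _ set_borel_integral_eq_integral(1)[OF int], of x])
      (auto intro!: continuous_intros intro: continuous_on_subset)
  then show ?thesis
    by (simp add: L1_norm_on_def set_borel_integral_eq_integral(2)[OF int])
qed

theorem proposition3p3:
  fixes \<Omega> :: "'a::euclidean_space set" and \<phi> :: "'a \<Rightarrow> real" and \<delta> :: real
  assumes "open \<Omega>" and "connected \<Omega>" and "bounded \<Omega>" and "\<Omega> \<noteq> {}"
    and "\<delta> > 0"
    and "C2_on_closure \<Omega> \<phi>"
    and "\<forall>x\<in>closure \<Omega>. \<phi> x \<ge> 0"
    and "\<exists>x\<in>closure \<Omega>. \<phi> x \<noteq> 0"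
    and "\<forall>x\<in>frontier \<Omega>. \<phi> x = 0"
  shows "\<forall>\<^sub>F lam in at_top. \<forall>u T.
           T = quenching_time \<Omega> u \<and> solves_F \<Omega> lam \<delta> T u \<longrightarrow>
           T \<le> ereal (L1_norm_on \<Omega> \<phi> /
                (3 * lam * L1_norm_on \<Omega> \<phi> - L1_norm_on \<Omega> (laplacian \<phi>)))"
proof -
  let ?P = "L1_norm_on \<Omega> \<phi>" and ?L = "L1_norm_on \<Omega> (laplacian \<phi>)"
  obtain x where "x \<in> \<Omega>" "\<phi> x \<noteq> 0"
    using assms(1,8,9) by (auto simp: frontier_def interior_open)
  then have P: "0 < ?P"
    using assms by (intro L1_norm_on_pos) (auto simp: C2_on_closure_def)
  \<comment> \<open>Large enough means that the denominator of the bound is positive.\<close>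
  have "\<forall>\<^sub>F lam in at_top. max 0 (?L / (3 * ?P)) < lam"
    by (rule eventually_gt_at_top)
  then show ?thesis
  proof eventually_elim
    case (elim lam)
    then have lam: "0 < lam" and D: "0 < 3 * lam * ?P - ?L"
      using P by (auto simp: divide_less_eq mult_ac)
    show ?case
    proof (intro allI impI, elim conjE)
      fix u T
      assume T: "T = quenching_time \<Omega> u" and u: "solves_F \<Omega> lam \<delta> T u"
      show "T \<le> ereal (?P / (3 * lam * ?P - ?L))"
      proof (rule ccontr)
        assume "\<not> T \<le> ereal (?P / (3 * lam * ?P - ?L))"
        then obtain t where t: "?P / (3 * lam * ?P - ?L) < t" "ereal t < T"
          using ereal_dense2 by (metis less_ereal.simps(1) not_le)
        have "0 < ?P / (3 * lam * ?P - ?L)" using P D by simp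
        with t(1) have "0 < t" by linarith
        then have "t * (3 * lam * ?P - ?L) \<le> ?P"
          using quenching_time_bound[OF assms(1,3,5) lam assms(6,7,9), of u t] u t T by simp
        with t(1) D show False by (simp add: divide_less_eq)
      qed
    qed
  qed
qed

end
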